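(* Let $A$ be a commutative ring, let $I,J$ be ideals of $A$, and let $\{I_\alpha\}_{\alpha\in\Gamma}$ be a family of ideals of $A$. Then: (1) $V_c(0)=\varnothing$; (2) $V_c(A)=\operatorname{CoSp}(A)$; (3) $V_c([I:J])=V_c(I)\cup V_c(J)$; (4) $V_c\left(\bigcap_{\alpha\in\Gamma} I_\alpha\right)=\bigcap_{\alpha\in\Gamma}V_c(I_\alpha)$.
   Context: All rings are commutative with identity. For ideals $I,J$ of a ring $A$, $\operatorname{Ann}(I)=\{a\in A\mid aI=0\}$ and $(J:I)=\{a\in A\mid aI\subseteq J\}$. The coproduct of $I$ and $J$ is the ideal $[I:J]:=(J:\operatorname{Ann}(I))=\{a\in A\mid a\operatorname{Ann}(I)\subseteq J\}$. An ideal $C$ of $A$ is coprime if $C\neq 0$ and, for all ideals $I,J$ of $A$, $C\subseteq [I:J]$ implies $C\subseteq I$ or $C\subseteq J$. $\operatorname{CoSp}(A)$ is the set of coprime ideals of $A$. For an ideal $I$ of $A$, $V_c(I):=\{C\in\operatorname{CoSp}(A)\mid C\subseteq I\}$. The empty intersection of ideals is $A$, and the empty intersection of subsets of $\operatorname{CoSp}(A)$ is $\operatorname{CoSp}(A)$. *)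

theory Defs
  imports "HOL-Algebra.Ideal"
begin

definition annihilator :: "('a, 'b) ring_scheme \<Rightarrow> 'a set \<Rightarrow> 'a set"
  where "annihilator R I = {a \<in> carrier R. \<forall>x\<in>I. a \<otimes>\<^bsub>R\<^esub> x = \<zero>\<^bsub>R\<^esub>}"

definition ideal_quotient :: "('a, 'b) ring_scheme \<Rightarrow> 'a set \<Rightarrow> 'a set \<Rightarrow> 'a set"
  where "ideal_quotient R J I = {a \<in> carrier R. \<forall>x\<in>I. a \<otimes>\<^bsub>R\<^esub> x \<in> J}"

text \<open>The coproduct \<open>[I : J] = (J : Ann I)\<close>; note the order of the arguments.\<close>

definition ideal_coproduct :: "('a, 'b) ring_scheme \<Rightarrow> 'a set \<Rightarrow> 'a set \<Rightarrow> 'a set"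
  where "ideal_coproduct R I J = ideal_quotient R J (annihilator R I)"

definition coprime_ideal :: "('a, 'b) ring_scheme \<Rightarrow> 'a set \<Rightarrow> bool"
  where "coprime_ideal R C \<longleftrightarrow> ideal C R \<and> C \<noteq> {\<zero>\<^bsub>R\<^esub>} \<and>
    (\<forall>I J. ideal I R \<longrightarrow> ideal J R \<longrightarrow> C \<subseteq> ideal_coproduct R I J \<longrightarrow> C \<subseteq> I \<or> C \<subseteq> J)"

definition CoSp :: "('a, 'b) ring_scheme \<Rightarrow> 'a set set"
  where "CoSp R = {C. coprime_ideal R C}"

definition V_c :: "('a, 'b) ring_scheme \<Rightarrow> 'a set \<Rightarrow> 'a set set"
  where "V_c R I = {C \<in> CoSp R. C \<subseteq> I}"

text \<open>Intersections of families are taken inside \<open>carrier R\<close> and \<open>CoSp R\<close>, so that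
  the empty intersections are \<open>carrier R\<close> and \<open>CoSp R\<close> rather than \<open>UNIV\<close>.\<close>

definition ideal_Inter :: "('a, 'b) ring_scheme \<Rightarrow> 'i set \<Rightarrow> ('i \<Rightarrow> 'a set) \<Rightarrow> 'a set"
  where "ideal_Inter R \<Gamma> F = carrier R \<inter> (\<Inter>\<alpha>\<in>\<Gamma>. F \<alpha>)"

definition CoSp_Inter :: "('a, 'b) ring_scheme \<Rightarrow> 'i set \<Rightarrow> ('i \<Rightarrow> 'a set set) \<Rightarrow> 'a set set"
  where "CoSp_Inter R \<Gamma> S = CoSp R \<inter> (\<Inter>\<alpha>\<in>\<Gamma>. S \<alpha>)"

end

theory Submission
  imports Defs
begin

text \<open>Apart from the coproduct, the claims are order theory: coprime ideals are nonzero and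
  lie in the carrier, and lying below an intersection means lying below each member. For the
  coproduct, one inclusion is the defining property of coprimeness. The other holds because the
  coproduct contains both factors (\<open>ideal_coproduct_upper1\<close>,
  \<open>ideal_coproduct_upper2\<close>), so anything below a factor is below the coproduct.\<close>

text \<open>Annihilation is symmetric by commutativity: elements of I kill Ann(I), so the products
  are zero and hence in J.\<close>

lemma (in cring) ideal_coproduct_upper1:
  assumes I: "ideal I R" and J: "ideal J R"
  shows "I \<subseteq> ideal_coproduct R I J"
proof
  fix a assume a: "a \<in> I"
  have aR: "a \<in> carrier R" using ideal.Icarr[OF I a] .
  have "a \<otimes> x \<in> J" if x: "x \<in> annihilator R I" for x
  proof -
    have "x \<in> carrier R" and "x \<otimes> a = \<zero>" using x a by (auto simp: annihilator_def)
    then have "a \<otimes> x = \<zero>" using aR by (simp add: m_comm)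
    then show ?thesis using additive_subgroup.zero_closed[OF ideal.axioms(1)[OF J]] by simp
  qed
  then show "a \<in> ideal_coproduct R I J"
    using aR by (auto simp: ideal_coproduct_def ideal_quotient_def)
qed

text \<open>J absorbs multiplication by ring elements, in particular by those of Ann(I).\<close>

lemma ideal_coproduct_upper2:
  assumes J: "ideal J R"
  shows "J \<subseteq> ideal_coproduct R I J"
  using ideal.Icarr[OF J] ideal.I_r_closed[OF J]
  by (auto simp: ideal_coproduct_def ideal_quotient_def annihilator_def)

lemma CoSpD_subset_carrier:
  assumes "C \<in> CoSp R"
  shows "C \<subseteq> carrier R"
  using assms ideal.Icarr by (fastforce simp: CoSp_def coprime_ideal_def)

lemma V_c_zero:
  "V_c R {\<zero>\<^bsub>R\<^esub>} = {}"
proof -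
  \<comment> \<open>Every ideal contains zero, so only the zero ideal fits, and coprimeness excludes
    it.\<close>
  have "C = {\<zero>\<^bsub>R\<^esub>}" if "ideal C R" and "C \<subseteq> {\<zero>\<^bsub>R\<^esub>}" for C
    using that additive_subgroup.zero_closed[OF ideal.axioms(1)] by blast
  then show ?thesis by (auto simp: V_c_def CoSp_def coprime_ideal_def)
qed

lemma V_c_carrier:
  "V_c R (carrier R) = CoSp R"
  by (auto simp: V_c_def dest: CoSpD_subset_carrier)

lemma (in cring) V_c_coproduct:
  assumes I: "ideal I R" and J: "ideal J R"
  shows "V_c R (ideal_coproduct R I J) = V_c R I \<union> V_c R J"
proof
  show "V_c R (ideal_coproduct R I J) \<subseteq> V_c R I \<union> V_c R J"
    using I J by (auto simp: V_c_def CoSp_def coprime_ideal_def)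
  show "V_c R I \<union> V_c R J \<subseteq> V_c R (ideal_coproduct R I J)"
    using ideal_coproduct_upper1[OF I J] ideal_coproduct_upper2[OF J, of I]
    unfolding V_c_def by blast
qed

text \<open>Coprime ideals lie in the carrier, so the extra \<open>carrier R\<close> in
  \<open>ideal_Inter\<close> imposes no condition on them; this also settles empty \<Gamma>.\<close>

lemma V_c_Inter:
  "V_c R (ideal_Inter R \<Gamma> F) = CoSp_Inter R \<Gamma> (\<lambda>\<alpha>. V_c R (F \<alpha>))"
  using CoSpD_subset_carrier unfolding V_c_def ideal_Inter_def CoSp_Inter_def by blast

theorem proposition13:
  fixes A :: "('a, 'b) ring_scheme" and I J :: "'a set"
    and \<Gamma> :: "'i set" and F :: "'i \<Rightarrow> 'a set"
  assumes "cring A"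
    and "ideal I A" and "ideal J A"
    and "\<And>\<alpha>. \<alpha> \<in> \<Gamma> \<Longrightarrow> ideal (F \<alpha>) A"
  shows "V_c A {\<zero>\<^bsub>A\<^esub>} = {} \<and>
    V_c A (carrier A) = CoSp A \<and>
    V_c A (ideal_coproduct A I J) = V_c A I \<union> V_c A J \<and>
    V_c A (ideal_Inter A \<Gamma> F) = CoSp_Inter A \<Gamma> (\<lambda>\<alpha>. V_c A (F \<alpha>))"
  using V_c_zero V_c_carrier cring.V_c_coproduct[OF assms(1-3)] V_c_Inter by blast

end
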